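(* Let $I=(\mathcal{M},\mathcal{J})$ be an instance of the makespan scheduling problem with feasibility AF $(\mathrm{Args}_F,\rightsquigarrow_F)$, let $S$ be a schedule, let $E\subseteq\mathrm{Args}_F$ be the extension corresponding to $S$ ($E\approx S$), let $D=(D^-,D^+)$ be fixed decisions, and let $(\mathrm{Args}_D,\rightsquigarrow_D)$ be the fixed decision AF. Then $S$ is feasible and satisfies $D$ if and only if $E$ is stable in $(\mathrm{Args}_D,\rightsquigarrow_D)$.
   Context: Makespan scheduling. An instance is a pair $(\mathcal{M},\mathcal{J})$ with machines $\mathcal{M}=\{1,\dots,m\}$ and jobs $\mathcal{J}=\{1,\dots,n\}$, $m,n\geq 1$, where each job $j$ has a processing time $p_j\ge 0$. A schedule is a matrix $S=(x_{i,j})\in\{0,1\}^{m\times n}$ ($x_{i,j}=1$ means job $j$ is assigned to machine $i$); no further constraint is imposed on a schedule. $S$ is feasible iff it meets the constraints (with auxiliary real variables $C_i$, $C_{\max}$): $C_{\max}\geq C_i$ for all $i\in\mathcal{M}$; $C_i=\sum_{j=1}^n x_{i,j}p_j$ for all $i\in\mathcal{M}$; and $\sum_{i=1}^m x_{i,j}=1$ for all $j\in\mathcal{J}$. Fixed decisions. Negative fixed decisions are a set $D^-=\mathcal{M}^-\times\mathcal{J}^-\subseteq\mathcal{M}\times\mathcal{J}$; positive fixed decisions are a set $D^+=\mathcal{M}^+\times\mathcal{J}^+\subseteq\mathcal{M}\times\mathcal{J}$; fixed decisions are a pair $D=(D^-,D^+)$ of such sets with $D^-\cap D^+=\emptyset$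 and such that there are no $(i,j),(k,j)\in D^+$ with $i\neq k$. $S$ satisfies $D^-$ iff $(i,j)\in D^-$ implies $x_{i,j}=0$; $S$ satisfies $D^+$ iff $(i,j)\in D^+$ implies $x_{i,j}=1$; $S$ satisfies $D$ iff it satisfies both $D^-$ and $D^+$. Abstract argumentation. An abstract argumentation framework (AF) is a directed graph $(\mathrm{Args},\rightsquigarrow)$ with a set $\mathrm{Args}$ of arguments and a binary attack relation $\rightsquigarrow$ on $\mathrm{Args}$ (self-attacks allowed). An extension is a set $E\subseteq\mathrm{Args}$. It is conflict-free iff there are no $a,b\in E$ (possibly equal) with $a\rightsquigarrow b$; it is stable iff it is conflict-free and for every $b\in\mathrm{Args}\setminus E$ there is $a\in E$ with $a\rightsquigarrow b$. Feasibility AF: $\mathrm{Args}_F=\{a_{i,j}: i\in\mathcal{M}, j\in\mathcal{J}\}$ (pairwise distinct arguments) and $a_{i,j}\rightsquigarrow_F a_{k,l}$ iff $i\neq k$ and $j=l$. Correspondence: $S\approx E$ means that for all $i,j$: $x_{i,j}=1$ iff $a_{i,j}\in E$. Fixed decision AF: $\mathrm{Args}_D=\mathrm{Args}_F$ and $$\rightsquigarrow_D\;=\;\bigl(\rightsquigarrow_F\cup\{(a_{i,j},a_{i,j}):(i,j)\in D^-\}\bigr)\setminus\{(a_{k,l},a_{i,j}):(i,j)\in D^+,\,(k,l)\in\mathcal{M}\times\mathcal{J}\}.$$ *)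

theory Defs
  imports Complex_Main
begin

record makespan =
  num_machines :: nat
  num_jobs :: nat
  proc_time :: "nat \<Rightarrow> real"

definition machines :: "makespan \<Rightarrow> nat set" where
  "machines I = {1..num_machines I}"

definition jobs :: "makespan \<Rightarrow> nat set" where
  "jobs I = {1..num_jobs I}"

definition makespan_instance :: "makespan \<Rightarrow> bool" where
  "makespan_instance I \<longleftrightarrow>
     num_machines I \<ge> 1 \<and> num_jobs I \<ge> 1 \<and> (\<forall>j\<in>jobs I. proc_time I j \<ge> 0)"

(* An m x n matrix over {0,1} is a function of which only the entries with indices in
   machines I and jobs I are meaningful; its values elsewhere are arbitrary and never used. *)
definition schedule :: "makespan \<Rightarrow> (nat \<Rightarrow> nat \<Rightarrow> nat) \<Rightarrow> bool" where
  "schedule I x \<longleftrightarrow> (\<forall>i\<in>machines I. \<forall>j\<in>jobs I. x i j \<in> {0, 1})"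

(* The completion times C and the makespan Cmax are auxiliary variables of the constraint
   system, hence existentially quantified. *)
definition feasible :: "makespan \<Rightarrow> (nat \<Rightarrow> nat \<Rightarrow> nat) \<Rightarrow> bool" where
  "feasible I x \<longleftrightarrow>
     (\<exists>(C :: nat \<Rightarrow> real) (Cmax :: real).
        (\<forall>i\<in>machines I. Cmax \<ge> C i) \<and>
        (\<forall>i\<in>machines I. C i = (\<Sum>j\<in>jobs I. real (x i j) * proc_time I j)) \<and>
        (\<forall>j\<in>jobs I. (\<Sum>i\<in>machines I. x i j) = 1))"

(* Decisions are given as a pair (negative, positive). *)
type_synonym decisions = "(nat \<times> nat) set \<times> (nat \<times> nat) set"

definition fixed_decisions :: "makespan \<Rightarrow> decisions \<Rightarrow> bool" where
  "fixed_decisions I D \<longleftrightarrow>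
     (\<exists>M J. fst D = M \<times> J \<and> M \<times> J \<subseteq> machines I \<times> jobs I) \<and>
     (\<exists>M J. snd D = M \<times> J \<and> M \<times> J \<subseteq> machines I \<times> jobs I) \<and>
     fst D \<inter> snd D = {} \<and>
     \<not> (\<exists>i k j. (i, j) \<in> snd D \<and> (k, j) \<in> snd D \<and> i \<noteq> k)"

definition satisfies_neg :: "(nat \<Rightarrow> nat \<Rightarrow> nat) \<Rightarrow> (nat \<times> nat) set \<Rightarrow> bool" where
  "satisfies_neg x Dneg \<longleftrightarrow> (\<forall>i j. (i, j) \<in> Dneg \<longrightarrow> x i j = 0)"

definition satisfies_pos :: "(nat \<Rightarrow> nat \<Rightarrow> nat) \<Rightarrow> (nat \<times> nat) set \<Rightarrow> bool" where
  "satisfies_pos x Dpos \<longleftrightarrow> (\<forall>i j. (i, j) \<in> Dpos \<longrightarrow> x i j = 1)"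

definition satisfies :: "(nat \<Rightarrow> nat \<Rightarrow> nat) \<Rightarrow> decisions \<Rightarrow> bool" where
  "satisfies x D \<longleftrightarrow> satisfies_neg x (fst D) \<and> satisfies_pos x (snd D)"

record 'a af =
  args :: "'a set"
  attacks :: "('a \<times> 'a) set"

definition conflict_free :: "'a af \<Rightarrow> 'a set \<Rightarrow> bool" where
  "conflict_free F E \<longleftrightarrow> \<not> (\<exists>a\<in>E. \<exists>b\<in>E. (a, b) \<in> attacks F)"

definition stable_extension :: "'a af \<Rightarrow> 'a set \<Rightarrow> bool" where
  "stable_extension F E \<longleftrightarrow>
     E \<subseteq> args F \<and> conflict_free F E \<and>
     (\<forall>b\<in>args F - E. \<exists>a\<in>E. (a, b) \<in> attacks F)"

(* Arg i j is the argument a_{i,j}; constructor injectivity makes them pairwise distinct. *)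
datatype arg = Arg nat nat

definition feasibility_af :: "makespan \<Rightarrow> arg af" where
  "feasibility_af I =
     \<lparr>args = {Arg i j | i j. i \<in> machines I \<and> j \<in> jobs I},
      attacks = {(Arg i j, Arg k l) | i j k l.
        i \<in> machines I \<and> j \<in> jobs I \<and> k \<in> machines I \<and> l \<in> jobs I \<and> i \<noteq> k \<and> j = l}\<rparr>"

definition corresponds :: "makespan \<Rightarrow> (nat \<Rightarrow> nat \<Rightarrow> nat) \<Rightarrow> arg set \<Rightarrow> bool" where
  "corresponds I x E \<longleftrightarrow>
     (\<forall>i\<in>machines I. \<forall>j\<in>jobs I. x i j = 1 \<longleftrightarrow> Arg i j \<in> E)"

definition fixed_decision_af :: "makespan \<Rightarrow> decisions \<Rightarrow> arg af" where
  "fixed_decision_af I D =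
     \<lparr>args = args (feasibility_af I),
      attacks =
        (attacks (feasibility_af I) \<union> {(Arg i j, Arg i j) | i j. (i, j) \<in> fst D})
        - {(Arg k l, Arg i j) | k l i j. (i, j) \<in> snd D \<and> (k, l) \<in> machines I \<times> jobs I}\<rparr>"

end

theory Submission
  imports Defs
begin

text \<open>
  A schedule is feasible iff every job is assigned to exactly one machine, so both sides of the
  equivalence can be compared job by job. A positively fixed argument loses all its attackers,
  hence lies in every stable extension and attacks the remaining arguments of its job; these keep
  their attackers because at most one machine is fixed positively per job. A negatively fixed
  argument attacks itself, and keeps this attack since no decision is fixed both ways.
\<close>

text \<open>The completion times are determined by their equations and a large enough makespan
  always exists, so only the assignment constraint restricts \<open>x\<close>.\<close>

lemma feasible_iff_unique_machine:
  assumes "schedule I x"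
  shows "feasible I x \<longleftrightarrow> (\<forall>j\<in>jobs I. \<exists>!i. i \<in> machines I \<and> x i j = 1)"
proof -
  have fin: "finite (machines I)"
    by (simp add: machines_def)
  have "feasible I x \<longleftrightarrow> (\<forall>j\<in>jobs I. (\<Sum>i\<in>machines I. x i j) = 1)"
  proof
    assume "\<forall>j\<in>jobs I. (\<Sum>i\<in>machines I. x i j) = 1"
    moreover define C where "C i = (\<Sum>j\<in>jobs I. real (x i j) * proc_time I j)" for i
    ultimately show "feasible I x"
      unfolding feasible_def using fin
      \<comment> \<open>If there are no machines, this \<open>Max\<close> is unspecified, but the
        bounds on it are then vacuous.\<close>
      by (intro exI[of _ C] exI[of _ "Max (C ` machines I)"]) simp
  qed (auto simp: feasible_def)
  also have "\<dots> \<longleftrightarrow> (\<forall>j\<in>jobs I. \<exists>!i. i \<in> machines I \<and> x i j = 1)"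
  proof (rule ball_cong[OF refl])
    fix j assume "j \<in> jobs I"
    \<comment> \<open>\<open>sum_eq_1_iff\<close> asks for one entry 1 and all others 0; for 0/1
      entries the latter is uniqueness.\<close>
    then have "x i j = 0 \<longleftrightarrow> x i j \<noteq> 1" if "i \<in> machines I" for i
      using assms that by (auto simp: schedule_def)
    then show "(\<Sum>i\<in>machines I. x i j) = 1 \<longleftrightarrow> (\<exists>!i. i \<in> machines I \<and> x i j = 1)"
      unfolding sum_eq_1_iff[OF fin] by metis
  qed
  finally show ?thesis .
qed

text \<open>The self-attack disjunct need not repeat \<open>i = k\<close>: for \<open>j = l\<close>,
  distinct machines attack each other anyway.\<close>

lemma attacks_fixed_decision_af_iff:
  assumes "i \<in> machines I" "j \<in> jobs I" "k \<in> machines I" "l \<in> jobs I"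
  shows "(Arg i j, Arg k l) \<in> attacks (fixed_decision_af I D) \<longleftrightarrow>
    j = l \<and> (i \<noteq> k \<or> (i, j) \<in> fst D) \<and> (k, l) \<notin> snd D"
  using assms by (auto simp: fixed_decision_af_def feasibility_af_def)

text \<open>Every attack stays within one job, so stability splits into conditions on single jobs,
  the form that feasibility has.\<close>

lemma stable_fixed_decision_af_iff:
  assumes "E \<subseteq> args (feasibility_af I)"
  shows "stable_extension (fixed_decision_af I D) E \<longleftrightarrow>
    (\<forall>j\<in>jobs I. \<forall>i\<in>machines I. \<forall>k\<in>machines I. Arg i j \<in> E \<longrightarrow> Arg k j \<in> E \<longrightarrow>
       (k, j) \<in> snd D \<or> i = k \<and> (i, j) \<notin> fst D) \<and>
    (\<forall>j\<in>jobs I. \<forall>k\<in>machines I. Arg k j \<notin> E \<longrightarrow>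
       (k, j) \<notin> snd D \<and> (\<exists>i\<in>machines I. Arg i j \<in> E))"
    (is "_ \<longleftrightarrow> ?cf \<and> ?attacked")
proof -
  let ?F = "fixed_decision_af I D"
  have args: "args ?F = {Arg i j | i j. i \<in> machines I \<and> j \<in> jobs I}"
    by (simp add: fixed_decision_af_def feasibility_af_def)
  have sub: "E \<subseteq> args ?F"
    using assms by (simp add: fixed_decision_af_def)
  have "conflict_free ?F E \<longleftrightarrow>
    (\<forall>i\<in>machines I. \<forall>j\<in>jobs I. \<forall>k\<in>machines I. \<forall>l\<in>jobs I.
      Arg i j \<in> E \<longrightarrow> Arg k l \<in> E \<longrightarrow> (Arg i j, Arg k l) \<notin> attacks ?F)"
    using sub unfolding conflict_free_def args by blast
  also have "\<dots> \<longleftrightarrow> ?cf"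
    by (auto simp: attacks_fixed_decision_af_iff)
  finally have cf: "conflict_free ?F E \<longleftrightarrow> ?cf" .
  have "(\<forall>b\<in>args ?F - E. \<exists>a\<in>E. (a, b) \<in> attacks ?F) \<longleftrightarrow>
    (\<forall>k\<in>machines I. \<forall>l\<in>jobs I. Arg k l \<notin> E \<longrightarrow>
      (\<exists>i\<in>machines I. \<exists>j\<in>jobs I. Arg i j \<in> E \<and> (Arg i j, Arg k l) \<in> attacks ?F))"
    using sub unfolding args by blast
  also have "\<dots> \<longleftrightarrow> ?attacked"
    \<comment> \<open>A member of \<open>E\<close> and an outsider of the same job have different
      machines, so the attack exists unless its target is fixed positively.\<close>
    by (simp add: attacks_fixed_decision_af_iff cong: conj_cong) blast
  finally show ?thesis
    unfolding stable_extension_def using sub cf by blast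
qed

theorem theorem3:
  fixes I :: makespan
    and S :: "nat \<Rightarrow> nat \<Rightarrow> nat"
    and E :: "arg set"
    and D :: decisions
  assumes "makespan_instance I"
    and "schedule I S"
    and "E \<subseteq> args (feasibility_af I)"
    and "corresponds I S E"
    and "fixed_decisions I D"
  shows "feasible I S \<and> satisfies S D \<longleftrightarrow> stable_extension (fixed_decision_af I D) E"
proof -
  have E: "S i j = 1 \<longleftrightarrow> Arg i j \<in> E" if "i \<in> machines I" "j \<in> jobs I" for i j
    using assms(4) that by (simp add: corresponds_def)
  have S0: "S i j = 0 \<longleftrightarrow> Arg i j \<notin> E" if "i \<in> machines I" "j \<in> jobs I" for i j
    using assms(2) E[OF that] that by (force simp: schedule_def)
  \<comment> \<open>\<open>satisfies\<close> quantifies over all naturals, whereas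
    \<open>corresponds\<close> only covers indices in range.\<close>
  have "fst D \<subseteq> machines I \<times> jobs I" "snd D \<subseteq> machines I \<times> jobs I"
    using assms(5) unfolding fixed_decisions_def by metis+
  then have neg: "(i, j) \<in> fst D \<Longrightarrow> i \<in> machines I \<and> j \<in> jobs I"
    and pos: "(i, j) \<in> snd D \<Longrightarrow> i \<in> machines I \<and> j \<in> jobs I" for i j
    by auto
  have disj: "(i, j) \<notin> snd D" if "(i, j) \<in> fst D" for i j
    using assms(5) that by (auto simp: fixed_decisions_def)
  have uniq: "i = k" if "(i, j) \<in> snd D" "(k, j) \<in> snd D" for i j k
    using assms(5) that unfolding fixed_decisions_def by blast
  have "1 \<in> machines I"
    using assms(1) by (simp add: makespan_instance_def machines_def)
  have feas: "feasible I S \<longleftrightarrow> (\<forall>j\<in>jobs I. \<exists>!i. i \<in> machines I \<and> Arg i j \<in> E)"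
    unfolding feasible_iff_unique_machine[OF assms(2)] using E by (simp cong: conj_cong)
  have sat: "satisfies S D \<longleftrightarrow>
    (\<forall>i j. (i, j) \<in> fst D \<longrightarrow> Arg i j \<notin> E) \<and> (\<forall>i j. (i, j) \<in> snd D \<longrightarrow> Arg i j \<in> E)"
    unfolding satisfies_def satisfies_neg_def satisfies_pos_def
    using E S0 neg pos by metis
  show ?thesis
    unfolding stable_fixed_decision_af_iff[OF assms(3)]
  proof (intro iffI conjI, goal_cases)
    case 1
    then show ?case unfolding feas sat by metis
  next
    case 2
    then show ?case unfolding feas sat by metis
  next
    case 3
    then have cf: "(k, j) \<in> snd D \<or> i = k \<and> (i, j) \<notin> fst D"
      if "j \<in> jobs I" "i \<in> machines I" "k \<in> machines I" "Arg i j \<in> E" "Arg k j \<in> E" for i j k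
      using that by blast
    show ?case
      unfolding feas
    proof
      fix j assume j: "j \<in> jobs I"
      \<comment> \<open>Either \<open>Arg 1 j\<close> is in \<open>E\<close>, or its attacker in
        \<open>E\<close> belongs to job \<open>j\<close>.\<close>
      have "\<exists>i. i \<in> machines I \<and> Arg i j \<in> E"
        using 3 j \<open>1 \<in> machines I\<close> by blast
      \<comment> \<open>If \<open>i\<close> and \<open>k\<close> differed, conflict-freeness in both
        directions would make both decisions positive, against \<open>uniq\<close>.\<close>
      moreover have "i = k" if "i \<in> machines I" "k \<in> machines I" "Arg i j \<in> E" "Arg k j \<in> E" for i k
        using cf[OF j that] cf[OF j that(2,1,4,3)] uniq by blast
      ultimately show "\<exists>!i. i \<in> machines I \<and> Arg i j \<in> E" by blast
    qed
  next
    case 4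
    \<comment> \<open>Negative decisions follow from conflict-freeness with \<open>i = k\<close>,
      positive ones because an outsider must have an attacker.\<close>
    then show ?case unfolding sat using neg pos disj by blast
  qed
qed

end
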